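(* Let $(X_\bullet,c_{X_\bullet})$ and $(Y_\bullet,c_{Y_\bullet})$ be $\mathbb{R}$-filtered closure spaces and let $\varepsilon\ge0$. Suppose there is an $\varepsilon$-correspondence $C:(X_\bullet,c_{X_\bullet})\rightrightarrows(Y_\bullet,c_{Y_\bullet})$. Then $(X_\bullet,c_{X_\bullet})$ and $(Y_\bullet,c_{Y_\bullet})$ are $\varepsilon$ one-step $(J_\top,\times)$-homotopy interleaved. Furthermore, if $\mathbf{D}$ is a category and $H:\mathbf{Cl}\to\mathbf{D}$ is a $(J_\top,\times)$-homotopy invariant functor, then the persistence modules $H(X_\bullet,c_{X_\bullet})$ and $H(Y_\bullet,c_{Y_\bullet})$ are $\varepsilon$-interleaved.
   Context: A (Čech) closure space $(X,c)$ is a set $X$ with a function $c:2^X\to 2^X$ such that $c(\varnothing)=\varnothing$, $A\subset c(A)$, and $c(A\cup B)=c(A)\cup c(B)$. A map $f:(X,c_X)\to(Y,c_Y)$ is continuous if $f(c_X(A))\subset c_Y(f(A))$ for all $A\subset X$; $\mathbf{Cl}$ is the category of closure spaces and continuous maps. A set $U$ is a neighborhood of $x$ if $x\notin c(X\setminus U)$. The product closure on $X\times Y$ is $(c_X\times c_Y)(A)=\{(x,y)\mid (U\times V)\cap A\neq\varnothing$ for all neighborhoods $U$ of $x$, $V$ of $y\}$. $J_\top=\{0,1\}$ with the indiscrete closure ($c(A)=\{0,1\}$ for $A\ne\varnothing$). Continuous $f,g:X\to Y$ are one-step $(J_\top,\times)$-homotopic if there is a continuous $H:X\times J_\top\to Y$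 with $H(x,0)=f(x)$, $H(x,1)=g(x)$; $\sim_{(J_\top,\times)}$ is the equivalence relation generated by this. A functor $H:\mathbf{Cl}\to\mathbf{D}$ is $(J_\top,\times)$-homotopy invariant if $f\sim_{(J_\top,\times)}g$ implies $H(f)=H(g)$. An $\mathbb{R}$-filtered closure space $(X_\bullet,c_{X_\bullet})$ is a family of closure spaces $(X_t,c_{X_t})_{t\in\mathbb{R}}$ such that for $s\le t$, $X_s\subset X_t$ and the inclusion is continuous. Write $X=\bigcup_tX_t$. It is viewed as a functor from $(\mathbb{R},\le)$ to $\mathbf{Cl}$; a functor from $(\mathbb{R},\le)$ to a category is called a persistence module. Applying $H$ elementwise gives $H(X_\bullet,c_{X_\bullet})$. A multivalued map $C:X\rightrightarrows Y$ is a subset $C\subset X\times Y$ projecting onto $X$; write $xCy$ for $(x,y)\in C$, $C(A)=\{y\mid\exists a\in A,\ aCy\}$. It is a correspondence if it also projects onto $Y$; $C^T=\{(y,x)\mid xCy\}$. A function $f:X\to Y$ is subordinate to $C$ if $xCf(x)$ for all $x$. A multivalued map $C:X\rightrightarrows Y$ (with $X=\bigcup_tX_t$, $Y=\bigcup_tY_t$) is an $\varepsilon$-multivalued map from $(X_\bullet,c_{X_\bullet})$ to $(Y_\bullet,c_{Y_\bullet})$ if for all $t$: (1) $x\in X_t$ and $xCy$ imply $y\in Y_{t+\varepsilon}$; (2) for all $A\subset X_t$ and all $f:X\to Y$ subordinate to $C$, $C(c_{X_t}(A))\subset c_{Y_{t+\varepsilon}}(f(A))$. A correspondence $C$ is an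 $\varepsilon$-correspondence if $C$ and $C^T$ are $\varepsilon$-multivalued maps. $(X_\bullet,c_{X_\bullet})$ and $(Y_\bullet,c_{Y_\bullet})$ are $\varepsilon$ one-step $(J_\top,\times)$-homotopy interleaved if there are morphisms (i.e. natural transformations; equivalently set maps $f:X\to Y$, $g:Y\to X$ with continuous restrictions $f|_{X_t}:X_t\to Y_{t+\varepsilon}$, $g|_{Y_t}:Y_t\to X_{t+\varepsilon}$ for all $t$) $f:X_\bullet\to Y_{\bullet+\varepsilon}$, $g:Y_\bullet\to X_{\bullet+\varepsilon}$ such that for all $t$, $g|_{Y_{t+\varepsilon}}\circ f|_{X_t}$ is one-step $(J_\top,\times)$-homotopic to the inclusion $X_t\hookrightarrow X_{t+2\varepsilon}$ and $f|_{X_{t+\varepsilon}}\circ g|_{Y_t}$ is one-step $(J_\top,\times)$-homotopic to the inclusion $Y_t\hookrightarrow Y_{t+2\varepsilon}$. Functors $M,N:(\mathbb{R},\le)\to\mathbf{D}$ are $\varepsilon$-interleaved if there are maps $\varphi_p:M_p\to N_{p+\varepsilon}$, $\psi_p:N_p\to M_{p+\varepsilon}$, natural in $p$, with $\psi_{p+\varepsilon}\varphi_p=M_{p\le p+2\varepsilon}$ and $\varphi_{p+\varepsilon}\psi_p=N_{p\le p+2\varepsilon}$ for all $p$. *)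

theory Defs
  imports Complex_Main "HOL-Library.FuncSet"
begin

record 'a cspace =
  pts :: "'a set"
  cl :: "'a set \<Rightarrow> 'a set"

text \<open>
  The closure operator is extensional on the powerset of the carrier, so that equality of
  records is equality of closure spaces.
\<close>

definition closure_space :: "'a cspace \<Rightarrow> bool" where
  "closure_space S \<longleftrightarrow>
     cl S \<in> Pow (pts S) \<rightarrow>\<^sub>E Pow (pts S) \<and>
     cl S {} = {} \<and>
     (\<forall>A. A \<subseteq> pts S \<longrightarrow> A \<subseteq> cl S A) \<and>
     (\<forall>A B. A \<subseteq> pts S \<longrightarrow> B \<subseteq> pts S \<longrightarrow> cl S (A \<union> B) = cl S A \<union> cl S B)"

definition cl_continuous :: "'a cspace \<Rightarrow> 'b cspace \<Rightarrow> ('a \<Rightarrow> 'b) \<Rightarrow> bool" where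
  "cl_continuous S T f \<longleftrightarrow>
     f \<in> pts S \<rightarrow> pts T \<and> (\<forall>A. A \<subseteq> pts S \<longrightarrow> f ` cl S A \<subseteq> cl T (f ` A))"

definition cl_nbhd :: "'a cspace \<Rightarrow> 'a \<Rightarrow> 'a set \<Rightarrow> bool" where
  "cl_nbhd S x U \<longleftrightarrow> U \<subseteq> pts S \<and> x \<notin> cl S (pts S - U)"

definition cl_prod :: "'a cspace \<Rightarrow> 'b cspace \<Rightarrow> ('a \<times> 'b) cspace" where
  "cl_prod S T =
     \<lparr> pts = pts S \<times> pts T,
       cl = (\<lambda>A \<in> Pow (pts S \<times> pts T).
               {(x, y). x \<in> pts S \<and> y \<in> pts T \<and>
                  (\<forall>U V. cl_nbhd S x U \<longrightarrow> cl_nbhd T y V \<longrightarrow> (U \<times> V) \<inter> A \<noteq> {})}) \<rparr>"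

definition J_top :: "nat cspace" where
  "J_top = \<lparr> pts = {0, 1}, cl = (\<lambda>A \<in> Pow {0, 1}. if A = {} then {} else {0, 1}) \<rparr>"

lemma closure_space_cl_subset:
  assumes "closure_space S" "A \<subseteq> pts S"
  shows "cl S A \<subseteq> pts S"
proof -
  have "cl S \<in> Pow (pts S) \<rightarrow>\<^sub>E Pow (pts S)"
    using assms(1) by (simp add: closure_space_def)
  moreover have "A \<in> Pow (pts S)"
    using assms(2) by simp
  ultimately have "cl S A \<in> Pow (pts S)"
    by (rule PiE_mem)
  then show ?thesis by simp
qed

lemma closure_space_mono:
  assumes "closure_space S" "A \<subseteq> B" "B \<subseteq> pts S"
  shows "cl S A \<subseteq> cl S B"
  using assms unfolding closure_space_def by (metis Un_upper1 order_trans sup.absorb_iff2)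

lemma cl_nbhd_Int:
  assumes "closure_space S" "cl_nbhd S x U" "cl_nbhd S x V"
  shows "cl_nbhd S x (U \<inter> V)"
  using assms unfolding cl_nbhd_def closure_space_def by (auto simp: Diff_Int)

lemma cl_nbhd_mem:
  assumes "closure_space S" "cl_nbhd S x U" "x \<in> pts S"
  shows "x \<in> U"
  using assms unfolding cl_nbhd_def closure_space_def by blast

lemma closure_space_J_top: "closure_space J_top"
  unfolding closure_space_def J_top_def by auto

lemma closure_space_prod:
  assumes S: "closure_space S" and T: "closure_space T"
  shows "closure_space (cl_prod S T)"
proof -
  let ?P = "cl_prod S T"
  have nbhd: "cl_nbhd S x (pts S)" "cl_nbhd T y (pts T)" for x y
    using S T unfolding cl_nbhd_def closure_space_def by auto
  have un: "cl ?P (A \<union> B) = cl ?P A \<union> cl ?P B"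
    if A: "A \<subseteq> pts ?P" and B: "B \<subseteq> pts ?P" for A B
  proof -
    have "cl ?P (A \<union> B) \<subseteq> cl ?P A \<union> cl ?P B"
    proof (rule subsetI, rule ccontr)
      fix p assume p: "p \<in> cl ?P (A \<union> B)" "p \<notin> cl ?P A \<union> cl ?P B"
      obtain x y where xy: "p = (x, y)" by force
      have AB: "A \<subseteq> pts S \<times> pts T" "B \<subseteq> pts S \<times> pts T" "A \<union> B \<subseteq> pts S \<times> pts T"
        using A B by (auto simp: cl_prod_def)
      have mem: "x \<in> pts S" "y \<in> pts T"
        and hit: "\<And>U V. cl_nbhd S x U \<Longrightarrow> cl_nbhd T y V \<Longrightarrow> (U \<times> V) \<inter> (A \<union> B) \<noteq> {}"
        using p(1) AB(3) unfolding xy cl_prod_def by simp_all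
      obtain U V where 1: "cl_nbhd S x U" "cl_nbhd T y V" "(U \<times> V) \<inter> A = {}"
        using p(2) AB(1) mem unfolding xy cl_prod_def by auto
      obtain U' V' where 2: "cl_nbhd S x U'" "cl_nbhd T y V'" "(U' \<times> V') \<inter> B = {}"
        using p(2) AB(2) mem unfolding xy cl_prod_def by auto
      show False
        using hit[OF cl_nbhd_Int[OF S 1(1) 2(1)] cl_nbhd_Int[OF T 1(2) 2(2)]] 1(3) 2(3) by blast
    qed
    moreover have "cl ?P A \<union> cl ?P B \<subseteq> cl ?P (A \<union> B)"
      using A B unfolding cl_prod_def by (auto simp: Int_Un_distrib)
    ultimately show ?thesis by blast
  qed
  have ext: "A \<subseteq> cl ?P A" if "A \<subseteq> pts ?P" for A
    using that cl_nbhd_mem[OF S] cl_nbhd_mem[OF T] unfolding cl_prod_def by fastforce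
  have fs: "cl ?P \<in> Pow (pts ?P) \<rightarrow>\<^sub>E Pow (pts ?P)"
    unfolding cl_prod_def by auto
  have "cl ?P {} = {}"
    using nbhd unfolding cl_prod_def by auto
  with un ext fs show ?thesis
    unfolding closure_space_def by blast
qed

definition one_step_homotopic :: "'a cspace \<Rightarrow> 'b cspace \<Rightarrow> ('a \<Rightarrow> 'b) \<Rightarrow> ('a \<Rightarrow> 'b) \<Rightarrow> bool" where
  "one_step_homotopic S T f g \<longleftrightarrow>
     cl_continuous S T f \<and> cl_continuous S T g \<and>
     (\<exists>h. cl_continuous (cl_prod S J_top) T h \<and>
          (\<forall>x \<in> pts S. h (x, 0) = f x \<and> h (x, 1) = g x))"

definition homotopic :: "'a cspace \<Rightarrow> 'b cspace \<Rightarrow> ('a \<Rightarrow> 'b) \<Rightarrow> ('a \<Rightarrow> 'b) \<Rightarrow> bool" where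
  "homotopic S T f g \<longleftrightarrow>
     cl_continuous S T f \<and> cl_continuous S T g \<and> equivclp (one_step_homotopic S T) f g"

record ('o, 'm) category_data =
  Obj :: "'o set"
  Arr :: "'m set"
  Dom :: "'m \<Rightarrow> 'o"
  Cod :: "'m \<Rightarrow> 'o"
  Ident :: "'o \<Rightarrow> 'm"
  Comp :: "'m \<Rightarrow> 'm \<Rightarrow> 'm"

definition Hom :: "('o, 'm) category_data \<Rightarrow> 'o \<Rightarrow> 'o \<Rightarrow> 'm set" where
  "Hom C a b = {f \<in> Arr C. Dom C f = a \<and> Cod C f = b}"

text \<open>Composition is written in applicative order: \<^term>\<open>Comp C g f\<close> is \<open>g\<close> after \<open>f\<close>.\<close>

locale category =
  fixes C :: "('o, 'm) category_data"
  assumes Dom_Obj: "f \<in> Arr C \<Longrightarrow> Dom C f \<in> Obj C"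
    and Cod_Obj: "f \<in> Arr C \<Longrightarrow> Cod C f \<in> Obj C"
    and Ident_Hom: "a \<in> Obj C \<Longrightarrow> Ident C a \<in> Hom C a a"
    and Comp_Hom: "f \<in> Hom C a b \<Longrightarrow> g \<in> Hom C b c \<Longrightarrow> Comp C g f \<in> Hom C a c"
    and Comp_Ident: "f \<in> Hom C a b \<Longrightarrow> Comp C f (Ident C a) = f"
    and Ident_Comp: "f \<in> Hom C a b \<Longrightarrow> Comp C (Ident C b) f = f"
    and Comp_assoc: "f \<in> Hom C a b \<Longrightarrow> g \<in> Hom C b c \<Longrightarrow> h \<in> Hom C c d \<Longrightarrow>
      Comp C h (Comp C g f) = Comp C (Comp C h g) f"

record ('o1, 'm1, 'o2, 'm2) functor_data =
  on_obj :: "'o1 \<Rightarrow> 'o2"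
  on_arr :: "'m1 \<Rightarrow> 'm2"

definition is_functor ::
    "('o1, 'm1) category_data \<Rightarrow> ('o2, 'm2) category_data \<Rightarrow> ('o1, 'm1, 'o2, 'm2) functor_data \<Rightarrow> bool" where
  "is_functor C D F \<longleftrightarrow>
     (\<forall>a \<in> Obj C. on_obj F a \<in> Obj D) \<and>
     (\<forall>a b. \<forall>f \<in> Hom C a b. on_arr F f \<in> Hom D (on_obj F a) (on_obj F b)) \<and>
     (\<forall>a \<in> Obj C. on_arr F (Ident C a) = Ident D (on_obj F a)) \<and>
     (\<forall>a b c. \<forall>f \<in> Hom C a b. \<forall>g \<in> Hom C b c.
        on_arr F (Comp C g f) = Comp D (on_arr F g) (on_arr F f))"

definition functor_comp ::
    "('o2, 'm2, 'o3, 'm3) functor_data \<Rightarrow> ('o1, 'm1, 'o2, 'm2) functor_data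
      \<Rightarrow> ('o1, 'm1, 'o3, 'm3) functor_data" where
  "functor_comp G F = \<lparr> on_obj = on_obj G \<circ> on_obj F, on_arr = on_arr G \<circ> on_arr F \<rparr>"

definition nat_trans ::
    "('o1, 'm1) category_data \<Rightarrow> ('o2, 'm2) category_data \<Rightarrow> ('o1, 'm1, 'o2, 'm2) functor_data
      \<Rightarrow> ('o1, 'm1, 'o2, 'm2) functor_data \<Rightarrow> ('o1 \<Rightarrow> 'm2) \<Rightarrow> bool" where
  "nat_trans C D F G \<phi> \<longleftrightarrow>
     (\<forall>a \<in> Obj C. \<phi> a \<in> Hom D (on_obj F a) (on_obj G a)) \<and>
     (\<forall>a b. \<forall>f \<in> Hom C a b. Comp D (\<phi> b) (on_arr F f) = Comp D (on_arr G f) (\<phi> a))"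

text \<open>The arrow \<open>s \<le> t\<close> of the poset of real numbers is the pair \<open>(s, t)\<close>.\<close>

definition real_cat :: "(real, real \<times> real) category_data" where
  "real_cat =
     \<lparr> Obj = UNIV, Arr = {(s, t). s \<le> t}, Dom = fst, Cod = snd,
       Ident = (\<lambda>t. (t, t)), Comp = (\<lambda>g f. (fst f, snd g)) \<rparr>"

datatype 'a cl_arrow = Cl_Arrow (cl_src: "'a cspace") (cl_fun: "'a \<Rightarrow> 'a") (cl_tgt: "'a cspace")

text \<open>
  The type \<open>'a\<close> plays the role of the universe: the objects are all closure spaces whose
  underlying set is a subset of \<open>'a\<close>. Underlying functions of arrows are extensional on
  the source, so that equality of arrows is equality of continuous maps.
\<close>

definition Cl :: "('a cspace, 'a cl_arrow) category_data" where
  "Cl =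
     \<lparr> Obj = {S. closure_space S},
       Arr = {Cl_Arrow S f T | S f T. closure_space S \<and> closure_space T \<and>
                f \<in> pts S \<rightarrow>\<^sub>E pts T \<and> cl_continuous S T f},
       Dom = cl_src,
       Cod = cl_tgt,
       Ident = (\<lambda>S. Cl_Arrow S (\<lambda>x \<in> pts S. x) S),
       Comp = (\<lambda>g f. Cl_Arrow (cl_src f) (compose (pts (cl_src f)) (cl_fun g) (cl_fun f)) (cl_tgt g)) \<rparr>"

definition homotopy_invariant :: "('a cspace, 'a cl_arrow, 'o, 'm) functor_data \<Rightarrow> bool" where
  "homotopy_invariant H \<longleftrightarrow>
     (\<forall>S T f g. Cl_Arrow S f T \<in> Arr Cl \<longrightarrow> Cl_Arrow S g T \<in> Arr Cl \<longrightarrow> homotopic S T f g \<longrightarrow>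
        on_arr H (Cl_Arrow S f T) = on_arr H (Cl_Arrow S g T))"

lemma category_real_cat: "category real_cat"
  by unfold_locales (auto simp: real_cat_def Hom_def)

lemma cl_continuous_compose:
  assumes "closure_space S" "closure_space T"
    "cl_continuous S T f" "cl_continuous T V g"
  shows "cl_continuous S V (compose (pts S) g f)"
  unfolding cl_continuous_def
proof (intro conjI allI impI)
  show "compose (pts S) g f \<in> pts S \<rightarrow> pts V"
    using assms(3,4) by (auto simp: cl_continuous_def compose_def)
next
  fix A assume A: "A \<subseteq> pts S"
  have fA: "f ` A \<subseteq> pts T" using assms(3) A by (auto simp: cl_continuous_def)
  have c: "cl S A \<subseteq> pts S" using assms(1) A by (rule closure_space_cl_subset)
  have img: "compose (pts S) g f ` B = g ` f ` B" if "B \<subseteq> pts S" for B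
    using that by (force simp: compose_def)
  have "g ` f ` cl S A \<subseteq> g ` cl T (f ` A)"
    using assms(3) A by (simp add: cl_continuous_def image_mono)
  also have "\<dots> \<subseteq> cl V (g ` f ` A)"
    using assms(4) fA by (simp add: cl_continuous_def)
  finally show "compose (pts S) g f ` cl S A \<subseteq> cl V (compose (pts S) g f ` A)"
    using img[OF A] img[OF c] by simp
qed

lemma cl_continuous_restrict_id:
  assumes "closure_space S" "cl_continuous S T (\<lambda>x. x)"
  shows "cl_continuous S T (\<lambda>x \<in> pts S. x)"
  unfolding cl_continuous_def
proof (intro conjI allI impI)
  show "(\<lambda>x \<in> pts S. x) \<in> pts S \<rightarrow> pts T"
    using assms(2) by (auto simp: cl_continuous_def)
next
  fix A assume A: "A \<subseteq> pts S"
  have c: "cl S A \<subseteq> pts S" using assms(1) A by (rule closure_space_cl_subset)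
  have img: "(\<lambda>x \<in> pts S. x) ` B = B" if "B \<subseteq> pts S" for B
    using that by force
  show "(\<lambda>x \<in> pts S. x) ` cl S A \<subseteq> cl T ((\<lambda>x \<in> pts S. x) ` A)"
    using assms(2) A img[OF A] img[OF c] by (auto simp: cl_continuous_def)
qed

lemma Hom_Cl_iff:
  "f \<in> Hom Cl S T \<longleftrightarrow>
     closure_space S \<and> closure_space T \<and>
     (\<exists>u. f = Cl_Arrow S u T \<and> u \<in> extensional (pts S) \<and> cl_continuous S T u)"
  by (auto simp: Cl_def Hom_def PiE_def cl_continuous_def)

lemma category_Cl: "category Cl"
proof
  fix f :: "'a cl_arrow" and g h and a b c d :: "'a cspace"
  show "f \<in> Arr Cl \<Longrightarrow> Dom Cl f \<in> Obj Cl" "f \<in> Arr Cl \<Longrightarrow> Cod Cl f \<in> Obj Cl"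
    by (auto simp: Cl_def)
  show "Ident Cl a \<in> Hom Cl a a" if "a \<in> Obj Cl"
  proof -
    have "closure_space a" using that by (simp add: Cl_def)
    moreover from this have "cl_continuous a a (\<lambda>x \<in> pts a. x)"
      by (rule cl_continuous_restrict_id) (simp add: cl_continuous_def)
    ultimately show ?thesis
      unfolding Hom_Cl_iff by (simp add: Cl_def)
  qed
  show "Comp Cl g f \<in> Hom Cl a c" if "f \<in> Hom Cl a b" "g \<in> Hom Cl b c"
    using that cl_continuous_compose[of a b _ c] compose_extensional
    unfolding Hom_Cl_iff by (fastforce simp: Cl_def)
  show "Comp Cl f (Ident Cl a) = f" if "f \<in> Hom Cl a b"
    using that unfolding Hom_Cl_iff
    by (auto simp: Cl_def compose_def fun_eq_iff extensional_def)
  show "Comp Cl (Ident Cl b) f = f" if "f \<in> Hom Cl a b"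
    using that unfolding Hom_Cl_iff cl_continuous_def
    by (auto simp: Cl_def compose_def fun_eq_iff extensional_def Pi_iff)
  show "Comp Cl h (Comp Cl g f) = Comp Cl (Comp Cl h g) f"
    if "f \<in> Hom Cl a b" "g \<in> Hom Cl b c" "h \<in> Hom Cl c d"
    using that unfolding Hom_Cl_iff cl_continuous_def
    by (auto simp: Cl_def compose_def fun_eq_iff Pi_iff)
qed

definition filtered_closure_space :: "(real \<Rightarrow> 'a cspace) \<Rightarrow> bool" where
  "filtered_closure_space X \<longleftrightarrow>
     (\<forall>t. closure_space (X t)) \<and>
     (\<forall>s t. s \<le> t \<longrightarrow> pts (X s) \<subseteq> pts (X t) \<and> cl_continuous (X s) (X t) (\<lambda>x. x))"

definition total_set :: "(real \<Rightarrow> 'a cspace) \<Rightarrow> 'a set" where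
  "total_set X = (\<Union>t. pts (X t))"

definition filtered_functor ::
    "(real \<Rightarrow> 'a cspace) \<Rightarrow> (real, real \<times> real, 'a cspace, 'a cl_arrow) functor_data" where
  "filtered_functor X =
     \<lparr> on_obj = X, on_arr = (\<lambda>(s, t). Cl_Arrow (X s) (\<lambda>x \<in> pts (X s). x) (X t)) \<rparr>"

definition persistence_module ::
    "('o, 'm) category_data \<Rightarrow> (real, real \<times> real, 'o, 'm) functor_data \<Rightarrow> bool" where
  "persistence_module D M \<longleftrightarrow> is_functor real_cat D M"

definition shift ::
    "real \<Rightarrow> (real, real \<times> real, 'o, 'm) functor_data \<Rightarrow> (real, real \<times> real, 'o, 'm) functor_data" where
  "shift \<epsilon> M =
     \<lparr> on_obj = (\<lambda>t. on_obj M (t + \<epsilon>)), on_arr = (\<lambda>(s, t). on_arr M (s + \<epsilon>, t + \<epsilon>)) \<rparr>"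

lemma persistence_module_filtered_functor:
  assumes "filtered_closure_space X"
  shows "persistence_module Cl (filtered_functor X)"
proof -
  have 1: "closure_space (X t)" for t
    using assms by (simp add: filtered_closure_space_def)
  have 2: "cl_continuous (X s) (X t) (\<lambda>x \<in> pts (X s). x)" "pts (X s) \<subseteq> pts (X t)" if "s \<le> t" for s t
    using assms that cl_continuous_restrict_id[OF 1] by (auto simp: filtered_closure_space_def)
  have 3: "on_arr (filtered_functor X) (s, t) \<in> Hom Cl (X s) (X t)" if "s \<le> t" for s t
    unfolding Hom_Cl_iff using 1 2(1)[OF that] by (simp add: filtered_functor_def)
  show ?thesis
    unfolding persistence_module_def is_functor_def
  proof (intro conjI ballI allI)
    fix a b f assume "f \<in> Hom real_cat a b"
    then have "f = (a, b)" "a \<le> b" by (auto simp: real_cat_def Hom_def)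
    then show "on_arr (filtered_functor X) f
        \<in> Hom Cl (on_obj (filtered_functor X) a) (on_obj (filtered_functor X) b)"
      using 3[of a b] by (simp add: filtered_functor_def)
  next
    fix a b c f g assume "f \<in> Hom real_cat a b" "g \<in> Hom real_cat b c"
    then have fg: "f = (a, b)" "g = (b, c)" "a \<le> b"
      by (auto simp: real_cat_def Hom_def)
    show "on_arr (filtered_functor X) (Comp real_cat g f) =
        Comp Cl (on_arr (filtered_functor X) g) (on_arr (filtered_functor X) f)"
      using 2(2)[OF fg(3)] unfolding fg(1,2)
      by (auto simp: real_cat_def filtered_functor_def Cl_def compose_def fun_eq_iff)
  qed (use 1 in \<open>simp_all add: real_cat_def filtered_functor_def Cl_def\<close>)
qed

definition interleaved ::
    "('o, 'm) category_data \<Rightarrow> real \<Rightarrow> (real, real \<times> real, 'o, 'm) functor_data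
      \<Rightarrow> (real, real \<times> real, 'o, 'm) functor_data \<Rightarrow> bool" where
  "interleaved D \<epsilon> M N \<longleftrightarrow>
     persistence_module D M \<and> persistence_module D N \<and>
     (\<exists>\<phi> \<psi>. nat_trans real_cat D M (shift \<epsilon> N) \<phi> \<and> nat_trans real_cat D N (shift \<epsilon> M) \<psi> \<and>
        (\<forall>p. Comp D (\<psi> (p + \<epsilon>)) (\<phi> p) = on_arr M (p, p + 2 * \<epsilon>) \<and>
             Comp D (\<phi> (p + \<epsilon>)) (\<psi> p) = on_arr N (p, p + 2 * \<epsilon>)))"

definition one_step_homotopy_interleaved ::
    "real \<Rightarrow> (real \<Rightarrow> 'a cspace) \<Rightarrow> (real \<Rightarrow> 'a cspace) \<Rightarrow> bool" where
  "one_step_homotopy_interleaved \<epsilon> X Y \<longleftrightarrow>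
     (\<exists>f g. nat_trans real_cat Cl (filtered_functor X) (shift \<epsilon> (filtered_functor Y)) f \<and>
            nat_trans real_cat Cl (filtered_functor Y) (shift \<epsilon> (filtered_functor X)) g \<and>
        (\<forall>t. one_step_homotopic (X t) (X (t + 2 * \<epsilon>))
               (cl_fun (Comp Cl (g (t + \<epsilon>)) (f t))) (\<lambda>x. x) \<and>
             one_step_homotopic (Y t) (Y (t + 2 * \<epsilon>))
               (cl_fun (Comp Cl (f (t + \<epsilon>)) (g t))) (\<lambda>y. y)))"

definition multivalued_map :: "'a set \<Rightarrow> 'b set \<Rightarrow> ('a \<times> 'b) set \<Rightarrow> bool" where
  "multivalued_map A B C \<longleftrightarrow> C \<subseteq> A \<times> B \<and> Domain C = A"

definition correspondence :: "'a set \<Rightarrow> 'b set \<Rightarrow> ('a \<times> 'b) set \<Rightarrow> bool" where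
  "correspondence A B C \<longleftrightarrow> multivalued_map A B C \<and> Range C = B"

definition subordinate :: "'a set \<Rightarrow> ('a \<times> 'b) set \<Rightarrow> ('a \<Rightarrow> 'b) \<Rightarrow> bool" where
  "subordinate A C f \<longleftrightarrow> (\<forall>x \<in> A. (x, f x) \<in> C)"

definition eps_multivalued_map ::
    "real \<Rightarrow> (real \<Rightarrow> 'a cspace) \<Rightarrow> (real \<Rightarrow> 'b cspace) \<Rightarrow> ('a \<times> 'b) set \<Rightarrow> bool" where
  "eps_multivalued_map \<epsilon> X Y C \<longleftrightarrow>
     multivalued_map (total_set X) (total_set Y) C \<and>
     (\<forall>t. (\<forall>x y. x \<in> pts (X t) \<longrightarrow> (x, y) \<in> C \<longrightarrow> y \<in> pts (Y (t + \<epsilon>))) \<and>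
          (\<forall>A f. A \<subseteq> pts (X t) \<longrightarrow> subordinate (total_set X) C f \<longrightarrow>
             C `` cl (X t) A \<subseteq> cl (Y (t + \<epsilon>)) (f ` A)))"

definition eps_correspondence ::
    "real \<Rightarrow> (real \<Rightarrow> 'a cspace) \<Rightarrow> (real \<Rightarrow> 'b cspace) \<Rightarrow> ('a \<times> 'b) set \<Rightarrow> bool" where
  "eps_correspondence \<epsilon> X Y C \<longleftrightarrow>
     correspondence (total_set X) (total_set Y) C \<and>
     eps_multivalued_map \<epsilon> X Y C \<and> eps_multivalued_map \<epsilon> Y X (C\<inverse>)"

end

theory Submission
  imports Defs
begin

text \<open>
  Since \<open>J_top\<close> is indiscrete, \<open>c(A) = c(\<pi>\<^sub>1 A) \<times> {0, 1}\<close> in \<open>X\<^sub>t \<times> J_top\<close>, and a homotopy between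
  \<open>u\<close> and \<open>v\<close> is continuous as soon as \<open>u c(A)\<close> and \<open>v c(A)\<close> lie in the closure of every \<open>B\<close> that
  contains \<open>u a\<close> or \<open>v a\<close> for each \<open>a \<in> A\<close>. For maps that move points only within the relation
  \<open>R = C O C\<inverse>\<close> this holds because \<open>R(c(A)) \<subseteq> c(B)\<close> whenever every point of \<open>A\<close> is \<open>R\<close>-related
  to a point of \<open>B\<close>. Both the inclusion and the composites of selections of \<open>C\<close> and \<open>C\<inverse>\<close> are
  such maps.
\<close>

section \<open>Composition and shifting of functors\<close>

lemma shift_functor_comp: "shift \<epsilon> (functor_comp H F) = functor_comp H (shift \<epsilon> F)"
  by (auto simp: shift_def functor_comp_def fun_eq_iff)

lemma is_functor_comp:
  assumes "is_functor A B F" "is_functor B D G"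
  shows "is_functor A D (functor_comp G F)"
proof -
  have F: "\<And>a. a \<in> Obj A \<Longrightarrow> on_obj F a \<in> Obj B \<and> on_arr F (Ident A a) = Ident B (on_obj F a)"
    "\<And>a b f. f \<in> Hom A a b \<Longrightarrow> on_arr F f \<in> Hom B (on_obj F a) (on_obj F b)"
    "\<And>a b c f g. f \<in> Hom A a b \<Longrightarrow> g \<in> Hom A b c \<Longrightarrow>
      on_arr F (Comp A g f) = Comp B (on_arr F g) (on_arr F f)"
    using assms(1) unfolding is_functor_def by blast+
  have G: "\<And>a. a \<in> Obj B \<Longrightarrow> on_obj G a \<in> Obj D \<and> on_arr G (Ident B a) = Ident D (on_obj G a)"
    "\<And>a b f. f \<in> Hom B a b \<Longrightarrow> on_arr G f \<in> Hom D (on_obj G a) (on_obj G b)"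
    "\<And>a b c f g. f \<in> Hom B a b \<Longrightarrow> g \<in> Hom B b c \<Longrightarrow>
      on_arr G (Comp B g f) = Comp D (on_arr G g) (on_arr G f)"
    using assms(2) unfolding is_functor_def by blast+
  show ?thesis
    unfolding is_functor_def functor_comp_def
    using F(1) F(2) F(3) G(1) G(2) G(3)[OF F(2) F(2)] by simp
qed

text \<open>Whiskering: \<open>H\<close> is applied to both sides of each naturality square.
  Functoriality of \<open>F\<close> and \<open>G\<close> ensures that the arrows in the square are
  composable, so that \<open>H\<close> distributes over both composites.\<close>

lemma nat_trans_functor_comp:
  assumes H: "is_functor B D H" and F: "is_functor A B F" and G: "is_functor A B G"
    and \<phi>: "nat_trans A B F G \<phi>" and A: "category A"
  shows "nat_trans A D (functor_comp H F) (functor_comp H G) (\<lambda>a. on_arr H (\<phi> a))"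
  unfolding nat_trans_def
proof (intro conjI ballI allI)
  fix a assume "a \<in> Obj A"
  then show "on_arr H (\<phi> a) \<in> Hom D (on_obj (functor_comp H F) a) (on_obj (functor_comp H G) a)"
    using H \<phi> by (simp add: nat_trans_def is_functor_def functor_comp_def)
next
  fix a b f assume f: "f \<in> Hom A a b"
  then have ab: "a \<in> Obj A" "b \<in> Obj A"
    using category.Dom_Obj[OF A] category.Cod_Obj[OF A] by (auto simp: Hom_def)
  have comp: "on_arr H (Comp B k h) = Comp D (on_arr H k) (on_arr H h)"
    if "h \<in> Hom B p q" "k \<in> Hom B q r" for h k p q r
    using H that unfolding is_functor_def by blast
  have \<phi>H: "\<phi> c \<in> Hom B (on_obj F c) (on_obj G c)" if "c \<in> Obj A" for c
    using \<phi> that by (simp add: nat_trans_def)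
  have FG: "on_arr F f \<in> Hom B (on_obj F a) (on_obj F b)"
    "on_arr G f \<in> Hom B (on_obj G a) (on_obj G b)"
    using F G f by (simp_all add: is_functor_def)
  have "Comp B (\<phi> b) (on_arr F f) = Comp B (on_arr G f) (\<phi> a)"
    using \<phi> f by (simp add: nat_trans_def)
  then show "Comp D (on_arr H (\<phi> b)) (on_arr (functor_comp H F) f) =
      Comp D (on_arr (functor_comp H G) f) (on_arr H (\<phi> a))"
    using comp[OF FG(1) \<phi>H[OF ab(2)]] comp[OF \<phi>H[OF ab(1)] FG(2)]
    by (simp add: functor_comp_def)
qed

lemma persistence_module_shift:
  assumes "persistence_module D M"
  shows "persistence_module D (shift \<epsilon> M)"
proof -
  have hom: "f \<in> Hom real_cat a b \<longleftrightarrow> f = (a, b) \<and> a \<le> b" for f a b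
    by (auto simp: real_cat_def Hom_def)
  have shift: "on_obj (shift \<epsilon> M) a = on_obj M (a + \<epsilon>)"
    "on_arr (shift \<epsilon> M) (a, b) = on_arr M (a + \<epsilon>, b + \<epsilon>)" for a b
    by (simp_all add: shift_def)
  have real: "Obj real_cat = UNIV" "Ident real_cat a = (a, a)"
    "Comp real_cat (b, c) (a, b) = (a, c)" for a b c
    by (simp_all add: real_cat_def)
  show ?thesis
    using assms unfolding persistence_module_def is_functor_def hom
    by (simp add: Ball_def hom shift real)
qed

section \<open>The closure on a product with \<open>J_top\<close>\<close>

text \<open>The only neighborhood of either point of \<open>J_top\<close> is \<open>{0, 1}\<close>,
  so the product condition tests the first coordinate alone. What remains is the description of the
  closure in \<open>S\<close> by neighborhoods.\<close>

lemma cl_prod_J_top: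
  assumes S: "closure_space S" and A: "A \<subseteq> pts S \<times> {0, 1}"
  shows "cl (cl_prod S J_top) A = cl S (fst ` A) \<times> {0, 1}"
proof -
  have B: "fst ` A \<subseteq> pts S" using A by auto
  have J: "cl_nbhd J_top y V \<longleftrightarrow> V = {0, 1}" if "y \<in> {0, 1}" for y V
  proof -
    have "y \<notin> (if {0, 1} - V = {} then {} else {0, 1}) \<longleftrightarrow> {0, 1} \<subseteq> V"
      using that by auto
    then show ?thesis unfolding cl_nbhd_def J_top_def by auto
  qed
  have meets: "U \<inter> fst ` A \<noteq> {} \<longleftrightarrow> (U \<times> {0, 1}) \<inter> A \<noteq> {}" for U
  proof
    assume "U \<inter> fst ` A \<noteq> {}"
    then obtain p where "p \<in> A" "fst p \<in> U" by blast
    moreover from this have "snd p \<in> {0, 1}" using A by auto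
    ultimately show "(U \<times> {0, 1}) \<inter> A \<noteq> {}" by (metis IntI SigmaI empty_iff prod.collapse)
  next
    assume "(U \<times> {0, 1}) \<inter> A \<noteq> {}"
    then show "U \<inter> fst ` A \<noteq> {}" by force
  qed
  have adherent: "x \<in> cl S (fst ` A) \<longleftrightarrow> (\<forall>U. cl_nbhd S x U \<longrightarrow> U \<inter> fst ` A \<noteq> {})"
    if x: "x \<in> pts S" for x
  proof (intro iffI allI impI notI)
    \<comment> \<open>If \<open>U\<close> misses the projection of \<open>A\<close>, that projection
      lies in \<open>pts S - U\<close>, and monotonicity puts \<open>x\<close> in the closure of
      \<open>pts S - U\<close>.\<close>
    fix U assume "x \<in> cl S (fst ` A)" "cl_nbhd S x U" "U \<inter> fst ` A = {}"
    then show False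
      using closure_space_mono[OF S, of "fst ` A" "pts S - U"] B by (auto simp: cl_nbhd_def)
  next
    assume *: "\<forall>U. cl_nbhd S x U \<longrightarrow> U \<inter> fst ` A \<noteq> {}"
    \<comment> \<open>Contrapositive: if \<open>x\<close> is not in the closure, the complement of
      the projection of \<open>A\<close> is itself a neighborhood of \<open>x\<close>, and it misses
      the projection.\<close>
    have "pts S - (pts S - fst ` A) = fst ` A" using B by blast
    then show "x \<in> cl S (fst ` A)"
      using *[rule_format, of "pts S - fst ` A"] by (auto simp: cl_nbhd_def)
  qed
  have "(\<forall>U V. cl_nbhd S x U \<longrightarrow> cl_nbhd J_top y V \<longrightarrow> (U \<times> V) \<inter> A \<noteq> {}) \<longleftrightarrow> x \<in> cl S (fst ` A)"
    if "x \<in> pts S" "y \<in> {0, 1}" for x y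
    unfolding J[OF that(2)] adherent[OF that(1)] meets by blast
  then have "(x, y) \<in> cl (cl_prod S J_top) A \<longleftrightarrow>
      x \<in> pts S \<and> y \<in> {0, 1} \<and> x \<in> cl S (fst ` A)" for x y
    using A by (simp add: cl_prod_def J_top_def cong: conj_cong)
  moreover have "cl S (fst ` A) \<subseteq> pts S" using closure_space_cl_subset[OF S B] .
  ultimately show ?thesis by auto
qed

section \<open>Closure estimates for multivalued maps and round trips\<close>

lemma eps_multivalued_map_pts:
  assumes "eps_multivalued_map \<epsilon> X Y C" "x \<in> pts (X t)" "(x, y) \<in> C"
  shows "y \<in> pts (Y (t + \<epsilon>))"
  using assms unfolding eps_multivalued_map_def by blast

text \<open>Only the values of a subordinate function on \<open>A\<close> enter the bound, so a
  selection over \<open>A\<close> suffices. It can therefore be chosen afresh for each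
  \<open>A\<close>, which \<open>round_trip_cl\<close> exploits.\<close>

lemma eps_multivalued_map_cl:
  assumes "eps_multivalued_map \<epsilon> X Y C" "A \<subseteq> pts (X t)"
    "\<And>a. a \<in> A \<Longrightarrow> (a, f a) \<in> C"
  shows "C `` cl (X t) A \<subseteq> cl (Y (t + \<epsilon>)) (f ` A)"
proof -
  \<comment> \<open>Off \<open>A\<close> any value related by \<open>C\<close> will do; one exists
    on \<open>total_set X\<close> because \<open>C\<close> has full domain.\<close>
  define f' where "f' x = (if x \<in> A then f x else SOME y. (x, y) \<in> C)" for x
  have "Domain C = total_set X"
    using assms(1) by (simp add: eps_multivalued_map_def multivalued_map_def)
  then have "(x, SOME y. (x, y) \<in> C) \<in> C" if "x \<in> total_set X" for x
    using that by (metis DomainE someI)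
  then have "subordinate (total_set X) C f'"
    using assms(3) by (auto simp: subordinate_def f'_def)
  then have "C `` cl (X t) A \<subseteq> cl (Y (t + \<epsilon>)) (f' ` A)"
    using assms(1,2) unfolding eps_multivalued_map_def by blast
  then show ?thesis by (simp add: f'_def)
qed

lemma subordinate_total_setD:
  assumes "subordinate (total_set X) C f" "x \<in> pts (X t)"
  shows "(x, f x) \<in> C"
  using assms by (auto simp: subordinate_def total_set_def)

lemma round_trip_pts:
  assumes "eps_multivalued_map \<epsilon> X Y C" "eps_multivalued_map \<epsilon> Y X (C\<inverse>)"
    and "x \<in> pts (X t)" "(x, z) \<in> C O C\<inverse>"
  shows "z \<in> pts (X (t + 2 * \<epsilon>))"
proof -
  obtain y where "(x, y) \<in> C" "(y, z) \<in> C\<inverse>" using assms(4) by blast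
  then have "z \<in> pts (X (t + \<epsilon> + \<epsilon>))"
    using assms(1-3) eps_multivalued_map_pts by metis
  then show ?thesis by (simp add: algebra_simps)
qed

text \<open>Each \<open>a\<close> in \<open>A\<close> shares a partner in \<open>Y\<close> with some
  point of \<open>B\<close>. Selecting that partner on the way out and that point of
  \<open>B\<close> on the way back makes the two successive closure bounds end inside the closure of
  \<open>B\<close>.\<close>

lemma round_trip_cl:
  assumes C: "eps_multivalued_map \<epsilon> X Y C" "eps_multivalued_map \<epsilon> Y X (C\<inverse>)"
    and X: "closure_space (X (t + 2 * \<epsilon>))"
    and A: "A \<subseteq> pts (X t)" and B: "B \<subseteq> pts (X (t + 2 * \<epsilon>))" and AB: "A \<subseteq> (C O C\<inverse>) `` B"
  shows "(C O C\<inverse>) `` cl (X t) A \<subseteq> cl (X (t + 2 * \<epsilon>)) B"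
proof -
  have "\<forall>a\<in>A. \<exists>y. (a, y) \<in> C \<and> (\<exists>b\<in>B. (b, y) \<in> C)" using AB by blast
  then obtain f where f: "\<And>a. a \<in> A \<Longrightarrow> (a, f a) \<in> C" "\<And>a. a \<in> A \<Longrightarrow> \<exists>b\<in>B. (b, f a) \<in> C"
    by metis
  then have "\<forall>y\<in>f ` A. \<exists>b\<in>B. (b, y) \<in> C" by blast
  then obtain g where g: "\<And>y. y \<in> f ` A \<Longrightarrow> g y \<in> B \<and> (g y, y) \<in> C"
    by metis
  have fA: "f ` A \<subseteq> pts (Y (t + \<epsilon>))"
    using A f(1) eps_multivalued_map_pts[OF C(1)] by blast
  have "(C O C\<inverse>) `` cl (X t) A = C\<inverse> `` (C `` cl (X t) A)"
    by (simp add: relcomp_Image)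
  also have "\<dots> \<subseteq> C\<inverse> `` cl (Y (t + \<epsilon>)) (f ` A)"
    using eps_multivalued_map_cl[OF C(1) A f(1)] by (simp add: Image_mono)
  also have "\<dots> \<subseteq> cl (X (t + \<epsilon> + \<epsilon>)) (g ` f ` A)"
    by (rule eps_multivalued_map_cl[OF C(2) fA]) (use g in auto)
  also have "\<dots> = cl (X (t + 2 * \<epsilon>)) (g ` f ` A)"
    by (simp add: algebra_simps)
  also have "\<dots> \<subseteq> cl (X (t + 2 * \<epsilon>)) B"
    by (rule closure_space_mono[OF X _ B]) (use g in auto)
  finally show ?thesis .
qed

text \<open>Continuity of \<open>u\<close>, \<open>v\<close> and the homotopy all comes from
  \<open>round_trip_cl\<close>, with the image of the map in the role of \<open>B\<close>. The
  covering condition there holds because \<open>C O C\<inverse>\<close> is symmetric.\<close>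

lemma round_trip_homotopic:
  assumes C: "eps_multivalued_map \<epsilon> X Y C" "eps_multivalued_map \<epsilon> Y X (C\<inverse>)"
    and X: "\<And>s. closure_space (X s)"
    and u: "\<And>x. x \<in> pts (X t) \<Longrightarrow> (x, u x) \<in> C O C\<inverse>"
    and v: "\<And>x. x \<in> pts (X t) \<Longrightarrow> (x, v x) \<in> C O C\<inverse>"
  shows "one_step_homotopic (X t) (X (t + 2 * \<epsilon>)) u v"
proof -
  let ?Z = "X (t + 2 * \<epsilon>)"
  have cont: "cl_continuous (X t) ?Z w" if w: "\<And>x. x \<in> pts (X t) \<Longrightarrow> (x, w x) \<in> C O C\<inverse>" for w
    unfolding cl_continuous_def
  proof (intro conjI allI impI)
    show w': "w \<in> pts (X t) \<rightarrow> pts ?Z" using round_trip_pts[OF C _ w] by blast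
    fix A assume A: "A \<subseteq> pts (X t)"
    have "w ` cl (X t) A \<subseteq> (C O C\<inverse>) `` cl (X t) A"
      using w closure_space_cl_subset[OF X A] by blast
    also have "\<dots> \<subseteq> cl ?Z (w ` A)"
      by (rule round_trip_cl[OF C X A]) (use w w' A in blast)+
    finally show "w ` cl (X t) A \<subseteq> cl ?Z (w ` A)" .
  qed
  \<comment> \<open>The homotopy jumps from \<open>u\<close> to \<open>v\<close>; every nonzero
    \<open>i\<close> counts as 1, so \<open>h (x, i)\<close> is related to \<open>x\<close> for all
    \<open>i\<close>.\<close>
  define h where "h = (\<lambda>(x, i::nat). if i = 0 then u x else v x)"
  have h: "(x, h (x, i)) \<in> C O C\<inverse>" if "x \<in> pts (X t)" for x i
    using u v that by (simp add: h_def)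
  have "cl_continuous (cl_prod (X t) J_top) ?Z h"
    unfolding cl_continuous_def
  proof (intro conjI allI impI)
    have P: "pts (cl_prod (X t) J_top) = pts (X t) \<times> {0, 1}"
      by (simp add: cl_prod_def J_top_def)
    show h': "h \<in> pts (cl_prod (X t) J_top) \<rightarrow> pts ?Z"
      unfolding P using round_trip_pts[OF C _ h] by blast
    fix A assume A: "A \<subseteq> pts (cl_prod (X t) J_top)"
    then have B: "fst ` A \<subseteq> pts (X t)" unfolding P by auto
    have rel: "(fst p, h p) \<in> C O C\<inverse>" if "fst p \<in> pts (X t)" for p
      using h[OF that, of "snd p"] by simp
    then have AB: "fst ` A \<subseteq> (C O C\<inverse>) `` (h ` A)"
      using B by fastforce
    \<comment> \<open>Both levels appear over each point of the closure, even if \<open>A\<close>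
      meets only one of them. This is harmless, since \<open>u x\<close> and \<open>v x\<close> are
      both related to \<open>x\<close>.\<close>
    have "h ` cl (cl_prod (X t) J_top) A = h ` (cl (X t) (fst ` A) \<times> {0, 1})"
      using cl_prod_J_top[OF X] A unfolding P by simp
    also have "\<dots> \<subseteq> (C O C\<inverse>) `` cl (X t) (fst ` A)"
      using rel closure_space_cl_subset[OF X B] by fastforce
    also have "\<dots> \<subseteq> cl ?Z (h ` A)"
      by (rule round_trip_cl[OF C X B _ AB]) (use h' A in blast)
    finally show "h ` cl (cl_prod (X t) J_top) A \<subseteq> cl ?Z (h ` A)" .
  qed
  then show ?thesis
    unfolding one_step_homotopic_def using cont[OF u] cont[OF v] by (auto simp: h_def)
qed

text \<open>The image under a selection lies in the image under \<open>C\<close>, which the closure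
  condition bounds by the closure of the image of that same selection.\<close>

lemma eps_multivalued_map_continuous:
  assumes C: "eps_multivalued_map \<epsilon> X Y C" and X: "closure_space (X t)"
    and f: "\<And>x. x \<in> pts (X t) \<Longrightarrow> (x, f x) \<in> C"
  shows "cl_continuous (X t) (Y (t + \<epsilon>)) f"
  unfolding cl_continuous_def
proof (intro conjI allI impI)
  show "f \<in> pts (X t) \<rightarrow> pts (Y (t + \<epsilon>))" using eps_multivalued_map_pts[OF C _ f] by blast
  fix A assume A: "A \<subseteq> pts (X t)"
  have "f ` cl (X t) A \<subseteq> C `` cl (X t) A"
    using f closure_space_cl_subset[OF X A] by blast
  also have "\<dots> \<subseteq> cl (Y (t + \<epsilon>)) (f ` A)"
    using eps_multivalued_map_cl[OF C A] f A by blast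
  finally show "f ` cl (X t) A \<subseteq> cl (Y (t + \<epsilon>)) (f ` A)" .
qed

section \<open>Selections as morphisms of filtered closure spaces\<close>

text \<open>One global \<open>f\<close> serves every \<open>t\<close>; it is restricted because
  arrows of \<open>Cl\<close> carry functions extensional on their source.\<close>

definition selection_trans ::
    "real \<Rightarrow> (real \<Rightarrow> 'a cspace) \<Rightarrow> (real \<Rightarrow> 'a cspace) \<Rightarrow> ('a \<Rightarrow> 'a) \<Rightarrow> real \<Rightarrow> 'a cl_arrow" where
  "selection_trans \<epsilon> X Y f t = Cl_Arrow (X t) (restrict f (pts (X t))) (Y (t + \<epsilon>))"

text \<open>The squares commute because all components restrict the same \<open>f\<close> and the
  other sides are inclusions.\<close>

lemma nat_trans_selection_trans:
  assumes C: "eps_multivalued_map \<epsilon> X Y C"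
    and X: "filtered_closure_space X" and Y: "filtered_closure_space Y"
    and sub: "subordinate (total_set X) C f"
  shows "nat_trans real_cat Cl (filtered_functor X) (shift \<epsilon> (filtered_functor Y))
    (selection_trans \<epsilon> X Y f)"
  unfolding nat_trans_def
proof (intro conjI ballI allI)
  have cs: "closure_space (X t)" "closure_space (Y t)" for t
    using X Y by (auto simp: filtered_closure_space_def)
  fix a
  have "cl_continuous (X a) (Y (a + \<epsilon>)) (restrict f (pts (X a)))"
    by (rule eps_multivalued_map_continuous[where C = C]) (use C cs subordinate_total_setD[OF sub] in auto)
  then show "selection_trans \<epsilon> X Y f a
      \<in> Hom Cl (on_obj (filtered_functor X) a) (on_obj (shift \<epsilon> (filtered_functor Y)) a)"
    using cs by (simp add: Hom_Cl_iff filtered_functor_def shift_def selection_trans_def)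
next
  fix a b p assume "p \<in> Hom real_cat a b"
  then have p: "p = (a, b)" "a \<le> b" by (auto simp: real_cat_def Hom_def)
  have "pts (X a) \<subseteq> pts (X b)" using X p(2) by (simp add: filtered_closure_space_def)
  \<comment> \<open>The restricted inclusion into the later stage of \<open>Y\<close> fixes
    \<open>f x\<close> only if \<open>f x\<close> lies in its source.\<close>
  moreover have "f x \<in> pts (Y (a + \<epsilon>))" if "x \<in> pts (X a)" for x
    using eps_multivalued_map_pts[OF C that subordinate_total_setD[OF sub that]] .
  ultimately show "Comp Cl (selection_trans \<epsilon> X Y f b) (on_arr (filtered_functor X) p) =
      Comp Cl (on_arr (shift \<epsilon> (filtered_functor Y)) p) (selection_trans \<epsilon> X Y f a)"
    by (auto simp: p(1) Cl_def filtered_functor_def shift_def selection_trans_def compose_def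
        fun_eq_iff)
qed

lemma selection_trans_round_trip:
  assumes C: "eps_multivalued_map \<epsilon> X Y C" "eps_multivalued_map \<epsilon> Y X (C\<inverse>)"
    and X: "filtered_closure_space X"
    and fg: "subordinate (total_set X) C f" "subordinate (total_set Y) (C\<inverse>) g"
  shows "one_step_homotopic (X t) (X (t + 2 * \<epsilon>))
    (cl_fun (Comp Cl (selection_trans \<epsilon> Y X g (t + \<epsilon>)) (selection_trans \<epsilon> X Y f t))) (\<lambda>x. x)"
proof (rule round_trip_homotopic[OF C])
  note f = subordinate_total_setD[OF fg(1)] and g = subordinate_total_setD[OF fg(2)]
  show "closure_space (X s)" for s using X by (simp add: filtered_closure_space_def)
  fix x assume x: "x \<in> pts (X t)"
  \<comment> \<open>The common partner is \<open>f x\<close>.\<close>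
  then show "(x, x) \<in> C O C\<inverse>" using f by blast
  \<comment> \<open>This makes the restricted \<open>g\<close> take its genuine value at
    \<open>f x\<close>; then \<open>f x\<close> links \<open>x\<close> to
    \<open>g (f x)\<close>.\<close>
  have "f x \<in> pts (Y (t + \<epsilon>))" using eps_multivalued_map_pts[OF C(1) x f[OF x]] .
  then show "(x, cl_fun (Comp Cl (selection_trans \<epsilon> Y X g (t + \<epsilon>)) (selection_trans \<epsilon> X Y f t)) x)
      \<in> C O C\<inverse>"
    using x f[OF x] g by (auto simp: Cl_def selection_trans_def compose_def)
qed

lemma eps_correspondence_homotopy_interleaved:
  assumes X: "filtered_closure_space X" and Y: "filtered_closure_space Y"
    and "eps_correspondence \<epsilon> X Y C"
  shows "one_step_homotopy_interleaved \<epsilon> X Y"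
proof -
  have C: "eps_multivalued_map \<epsilon> X Y C" "eps_multivalued_map \<epsilon> Y X (C\<inverse>)"
    "Domain C = total_set X" "Range C = total_set Y"
    using assms(3) by (auto simp: eps_correspondence_def correspondence_def multivalued_map_def)
  \<comment> \<open>The statements about \<open>Y\<close> are those about \<open>X\<close> applied
    to \<open>C\<inverse>\<close>, whose converse then appears as
    \<open>(C\<inverse>)\<inverse>\<close>.\<close>
  then have C': "eps_multivalued_map \<epsilon> X Y ((C\<inverse>)\<inverse>)" by simp
  have "\<forall>x\<in>total_set X. \<exists>y. (x, y) \<in> C" "\<forall>y\<in>total_set Y. \<exists>x. (x, y) \<in> C"
    using C(3,4) by blast+
  then obtain f g where f: "subordinate (total_set X) C f"
    and g: "subordinate (total_set Y) (C\<inverse>) g"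
    unfolding subordinate_def converse_iff by metis
  have f': "subordinate (total_set X) ((C\<inverse>)\<inverse>) f" using f by simp
  show ?thesis
    unfolding one_step_homotopy_interleaved_def
    using nat_trans_selection_trans[OF C(1) X Y f] nat_trans_selection_trans[OF C(2) Y X g]
      selection_trans_round_trip[OF C(1,2) X f g] selection_trans_round_trip[OF C(2) C' Y g f']
    by blast
qed

section \<open>Passage to persistence modules\<close>

text \<open>Bridges two forms of the inclusion: the homotopy ends at the total identity function,
  whereas the arrow of \<open>filtered_functor X\<close> carries its restriction. A homotopy
  constrains its ends only on the points of the source, so one may replace the other.\<close>

lemma homotopy_invariant_eq_inclusion:
  assumes H: "homotopy_invariant H" and X: "filtered_closure_space X" and st: "s \<le> t"
    and k: "k \<in> Hom Cl (X s) (X t)" and "one_step_homotopic (X s) (X t) (cl_fun k) (\<lambda>x. x)"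
  shows "on_arr H k = on_arr H (on_arr (filtered_functor X) (s, t))"
proof -
  let ?i = "\<lambda>x \<in> pts (X s). x"
  have cs: "closure_space (X r)" for r using X by (simp add: filtered_closure_space_def)
  obtain u where u: "k = Cl_Arrow (X s) u (X t)" using k by (auto simp: Hom_Cl_iff)
  have i: "cl_continuous (X s) (X t) ?i" "pts (X s) \<subseteq> pts (X t)"
    using X st cl_continuous_restrict_id[OF cs] by (auto simp: filtered_closure_space_def)
  have "one_step_homotopic (X s) (X t) u ?i"
    using assms(5) i(1) unfolding one_step_homotopic_def u by simp
  then have "homotopic (X s) (X t) u ?i"
    by (simp add: homotopic_def one_step_homotopic_def r_into_equivclp)
  moreover have "Cl_Arrow (X s) u (X t) \<in> Arr Cl" using k u by (simp add: Hom_def)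
  moreover have "Cl_Arrow (X s) ?i (X t) \<in> Arr Cl" using cs i by (auto simp: Cl_def)
  ultimately show ?thesis
    using H unfolding homotopy_invariant_def u filtered_functor_def by simp
qed

text \<open>Applying \<open>H\<close> to the two morphisms turns the homotopies into equalities,
  which are the interleaving identities.\<close>

lemma homotopy_interleaved_imp_interleaved:
  assumes X: "filtered_closure_space X" and Y: "filtered_closure_space Y" and \<epsilon>: "\<epsilon> \<ge> 0"
    and "one_step_homotopy_interleaved \<epsilon> X Y"
    and HF: "is_functor Cl D H" and HI: "homotopy_invariant H"
  shows "interleaved D \<epsilon> (functor_comp H (filtered_functor X)) (functor_comp H (filtered_functor Y))"
proof -
  obtain f g where
      f: "nat_trans real_cat Cl (filtered_functor X) (shift \<epsilon> (filtered_functor Y)) f"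
    and g: "nat_trans real_cat Cl (filtered_functor Y) (shift \<epsilon> (filtered_functor X)) g"
    and gf: "\<And>t. one_step_homotopic (X t) (X (t + 2 * \<epsilon>)) (cl_fun (Comp Cl (g (t + \<epsilon>)) (f t))) (\<lambda>x. x)"
    and fg: "\<And>t. one_step_homotopic (Y t) (Y (t + 2 * \<epsilon>)) (cl_fun (Comp Cl (f (t + \<epsilon>)) (g t))) (\<lambda>y. y)"
    using assms(4) unfolding one_step_homotopy_interleaved_def by blast
  have functors: "is_functor real_cat Cl (filtered_functor W)"
      "is_functor real_cat Cl (shift \<epsilon> (filtered_functor W))"
    if "filtered_closure_space W" for W :: "real \<Rightarrow> 'a cspace"
    using persistence_module_filtered_functor[OF that] persistence_module_shift
    by (auto simp: persistence_module_def)
  \<comment> \<open>Stated for arbitrary \<open>V\<close> and \<open>W\<close>, so that exchanging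
    \<open>X\<close> and \<open>Y\<close> yields both identities. Nonnegativity of
    \<open>\<epsilon>\<close> makes \<open>(p, p + 2 * \<epsilon>)\<close> an arrow of
    \<open>real_cat\<close>.\<close>
  have comp: "Comp D (on_arr H (l (p + \<epsilon>))) (on_arr H (k p)) =
      on_arr H (on_arr (filtered_functor V) (p, p + 2 * \<epsilon>))"
    if V: "filtered_closure_space V"
      and k: "nat_trans real_cat Cl (filtered_functor V) (shift \<epsilon> (filtered_functor W)) k"
      and l: "nat_trans real_cat Cl (filtered_functor W) (shift \<epsilon> (filtered_functor V)) l"
      and lk: "one_step_homotopic (V p) (V (p + 2 * \<epsilon>)) (cl_fun (Comp Cl (l (p + \<epsilon>)) (k p))) (\<lambda>x. x)"
    for V W :: "real \<Rightarrow> 'a cspace" and k l p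
  proof -
    have kp: "k p \<in> Hom Cl (V p) (W (p + \<epsilon>))"
      using k by (simp add: nat_trans_def shift_def filtered_functor_def real_cat_def)
    have "l q \<in> Hom Cl (W q) (V (q + \<epsilon>))" for q
      using l by (simp add: nat_trans_def shift_def filtered_functor_def real_cat_def)
    from this[of "p + \<epsilon>"] have lp: "l (p + \<epsilon>) \<in> Hom Cl (W (p + \<epsilon>)) (V (p + 2 * \<epsilon>))"
      by (simp add: add.assoc)
    have "Comp D (on_arr H (l (p + \<epsilon>))) (on_arr H (k p)) = on_arr H (Comp Cl (l (p + \<epsilon>)) (k p))"
      using HF kp lp unfolding is_functor_def by simp
    also have "\<dots> = on_arr H (on_arr (filtered_functor V) (p, p + 2 * \<epsilon>))"
      using homotopy_invariant_eq_inclusion[OF HI V _ category.Comp_Hom[OF category_Cl kp lp] lk] \<epsilon>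
      by simp
    finally show ?thesis .
  qed
  have trans: "nat_trans real_cat D (functor_comp H (filtered_functor V))
      (shift \<epsilon> (functor_comp H (filtered_functor W))) (\<lambda>p. on_arr H (k p))"
    if V: "filtered_closure_space V" and W: "filtered_closure_space W"
      and k: "nat_trans real_cat Cl (filtered_functor V) (shift \<epsilon> (filtered_functor W)) k"
    for V W :: "real \<Rightarrow> 'a cspace" and k
    unfolding shift_functor_comp
    by (rule nat_trans_functor_comp[OF HF functors(1)[OF V] functors(2)[OF W] k category_real_cat])
  have pers: "persistence_module D (functor_comp H (filtered_functor V))"
    if "filtered_closure_space V" for V
    unfolding persistence_module_def by (rule is_functor_comp[OF functors(1)[OF that] HF])
  have on_arr_comp: "on_arr (functor_comp H (filtered_functor V)) a =
      on_arr H (on_arr (filtered_functor V) a)" for V a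
    by (simp add: functor_comp_def)
  have "\<forall>p. Comp D (on_arr H (g (p + \<epsilon>))) (on_arr H (f p)) =
        on_arr (functor_comp H (filtered_functor X)) (p, p + 2 * \<epsilon>) \<and>
      Comp D (on_arr H (f (p + \<epsilon>))) (on_arr H (g p)) =
        on_arr (functor_comp H (filtered_functor Y)) (p, p + 2 * \<epsilon>)"
    unfolding on_arr_comp using comp[of X Y, OF X f g gf] comp[of Y X, OF Y g f fg]
    by simp
  with trans[OF X Y f] trans[OF Y X g] pers[OF X] pers[OF Y] show ?thesis
    unfolding interleaved_def
    by (intro conjI exI[of _ "\<lambda>p. on_arr H (f p)"] exI[of _ "\<lambda>p. on_arr H (g p)"])
qed

theorem theorem8p26:
  fixes X Y :: "real \<Rightarrow> 'a cspace" and \<epsilon> :: real and C :: "('a \<times> 'a) set"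
  assumes "filtered_closure_space X" and "filtered_closure_space Y"
    and "\<epsilon> \<ge> 0"
    and "eps_correspondence \<epsilon> X Y C"
  shows "one_step_homotopy_interleaved \<epsilon> X Y \<and>
    (\<forall>(D :: ('o, 'm) category_data) (H :: ('a cspace, 'a cl_arrow, 'o, 'm) functor_data).
       category D \<longrightarrow> is_functor Cl D H \<longrightarrow> homotopy_invariant H \<longrightarrow>
       interleaved D \<epsilon> (functor_comp H (filtered_functor X)) (functor_comp H (filtered_functor Y)))"
  using eps_correspondence_homotopy_interleaved[OF assms(1,2,4)]
    homotopy_interleaved_imp_interleaved[OF assms(1-3)]
  by blast

end
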